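(* Let $\beta_1,\beta_2\in(0,1)$ with $\beta_1>\beta_2$, let $\tau_{Q,1},\tau_{Q,2}>0$ and $\sigma_Z\ge 0$, and define $$\alpha_{th}=\frac{\tau_{Q,2}-\tau_{Q,1}+\tau_{Q,1}\beta_2-\tau_{Q,2}\beta_1}{\tau_{Q,2}-\tau_{Q,1}+2\tau_{Q,1}\beta_2-2\tau_{Q,2}\beta_1}.$$ Then: (i) if $\frac{\tau_{Q,1}}{\tau_{Q,2}}>\frac{\beta_1}{\beta_2}$, university $\mathcal{U}_1$ is more selective for all $\alpha\in(0,1)$; (ii) if $\frac{\tau_{Q,1}}{\tau_{Q,2}}<\frac{1-\beta_1}{1-\beta_2}$, university $\mathcal{U}_2$ is more selective for all $\alpha\in(0,1)$; (iii) if $\frac{1-\beta_1}{1-\beta_2}\le\frac{\tau_{Q,1}}{\tau_{Q,2}}\le\frac{\beta_1}{\beta_2}$, then for $\alpha\in(0,1)$: $\mathcal{U}_1$ is more selective when $\alpha<\alpha_{th}$, $\mathcal{U}_2$ is more selective when $\alpha>\alpha_{th}$, and both universities are equally selective when $\alpha=\alpha_{th}$.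
   Context: Two universities $\mathcal{U}_1,\mathcal{U}_2$ use a common admission score $A=\alpha t+(1-\alpha)s+\sigma_Z Z$ with $\alpha\in(0,1)$, where $t,s,Z$ are mutually independent standard normal random variables (a student's type, soft skill, and noise). University $\mathcal{U}_i$ has preference parameter $\beta_i$, quality metric $Q_i=\beta_i t+(1-\beta_i)s$ and quality threshold $\tau_{Q,i}$, and admits a student with score $a$ iff $\mathbb{E}[Q_i\mid A=a]\ge\tau_{Q,i}$. Equivalently, with $\sigma_\alpha^2=\alpha^2+(1-\alpha)^2+\sigma_Z^2$, it admits iff $A\ge\tau_{A,i}:=\dfrac{\tau_{Q,i}\sigma_\alpha^2}{\alpha\beta_i+(1-\alpha)(1-\beta_i)}$. University $\mathcal{U}_1$ is called more selective iff $\tau_{A,1}>\tau_{A,2}$; $\mathcal{U}_2$ is more selective iff $\tau_{A,2}>\tau_{A,1}$; they are equally selective iff $\tau_{A,1}=\tau_{A,2}$. *)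

theory Defs
  imports "HOL-Probability.Probability"
begin

definition score_var :: "real \<Rightarrow> real \<Rightarrow> real" where
  "score_var \<alpha> \<sigma>Z = \<alpha>\<^sup>2 + (1 - \<alpha>)\<^sup>2 + \<sigma>Z\<^sup>2"

definition score_threshold :: "real \<Rightarrow> real \<Rightarrow> real \<Rightarrow> real \<Rightarrow> real" where
  "score_threshold \<alpha> \<sigma>Z \<beta> \<tau>Q =
     \<tau>Q * score_var \<alpha> \<sigma>Z / (\<alpha> * \<beta> + (1 - \<alpha>) * (1 - \<beta>))"

text \<open>A university is given by its preference parameter and its quality threshold,
  in this order.\<close>

type_synonym university = "real \<times> real"

definition more_selective :: "real \<Rightarrow> real \<Rightarrow> university \<Rightarrow> university \<Rightarrow> bool" where
  "more_selective \<alpha> \<sigma>Z U V \<longleftrightarrow>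
     score_threshold \<alpha> \<sigma>Z (fst U) (snd U) > score_threshold \<alpha> \<sigma>Z (fst V) (snd V)"

definition equally_selective :: "real \<Rightarrow> real \<Rightarrow> university \<Rightarrow> university \<Rightarrow> bool" where
  "equally_selective \<alpha> \<sigma>Z U V \<longleftrightarrow>
     score_threshold \<alpha> \<sigma>Z (fst U) (snd U) = score_threshold \<alpha> \<sigma>Z (fst V) (snd V)"

definition alpha_th :: "real \<Rightarrow> real \<Rightarrow> real \<Rightarrow> real \<Rightarrow> real" where
  "alpha_th \<beta>1 \<beta>2 \<tau>1 \<tau>2 =
     (\<tau>2 - \<tau>1 + \<tau>1 * \<beta>2 - \<tau>2 * \<beta>1) / (\<tau>2 - \<tau>1 + 2 * \<tau>1 * \<beta>2 - 2 * \<tau>2 * \<beta>1)"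


text \<open>The rest of this theory justifies \<^const>\<open>score_threshold\<close>: in the Gaussian model,
  admission on the conditional expectation of the quality given the score coincides almost
  surely with comparing the score to \<^const>\<open>score_threshold\<close>.\<close>

lemma normal_density_mult_shift:
  fixes a b :: real
  assumes [arith]: "0 < a" "0 < b"
  shows "normal_density 0 a x * normal_density 0 b (z - x) =
    normal_density 0 (sqrt (a\<^sup>2 + b\<^sup>2)) z *
    normal_density (a\<^sup>2 * z / (a\<^sup>2 + b\<^sup>2)) (sqrt (a\<^sup>2 * b\<^sup>2 / (a\<^sup>2 + b\<^sup>2))) x"
proof -
  define a' b' where "a' = a\<^sup>2" and "b' = b\<^sup>2"
  then have [simp, arith]: "0 < a'" "0 < b'"
    by simp_all
  have sqrt: "(sqrt (2 * pi * (a' + b')) * sqrt (2 * pi * (a' * b') / (a' + b'))) =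
    (sqrt (2 * pi * a') * sqrt (2 * pi * b'))"
    by (subst power_eq_iff_eq_base[symmetric, where n=2])
       (simp_all add: real_sqrt_mult[symmetric] power2_eq_square)
  show ?thesis
    apply (simp add: normal_density_def a'_def[symmetric] b'_def[symmetric] sqrt mult_exp_exp)
    apply (simp add: divide_simps power2_eq_square)
    apply (simp add: algebra_simps)
    done
qed

context prob_space
begin

lemma distributed_sum_fst_normal:
  assumes ind: "indep_var borel X borel Y"
    and a: "0 < a" and b: "0 < b"
    and X: "distributed M lborel X (normal_density 0 a)"
    and Y: "distributed M lborel Y (normal_density 0 b)"
  shows "distributed M (lborel \<Otimes>\<^sub>M lborel) (\<lambda>\<omega>. (X \<omega> + Y \<omega>, X \<omega>))
    (\<lambda>(z, x). ennreal (normal_density 0 (sqrt (a\<^sup>2 + b\<^sup>2)) z *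
       normal_density (a\<^sup>2 * z / (a\<^sup>2 + b\<^sup>2)) (sqrt (a\<^sup>2 * b\<^sup>2 / (a\<^sup>2 + b\<^sup>2))) x))"
    (is "distributed _ _ _ ?f")
proof -
  have mX[measurable]: "X \<in> borel_measurable M" and mY[measurable]: "Y \<in> borel_measurable M"
    using distributed_measurable[OF X] distributed_measurable[OF Y] by auto
  have f_eq: "?f = (\<lambda>(z, x). ennreal (normal_density 0 a x * normal_density 0 b (z - x)))"
    using normal_density_mult_shift[OF a b] by (auto simp: fun_eq_iff)
  have J: "distributed M (lborel \<Otimes>\<^sub>M lborel) (\<lambda>\<omega>. (X \<omega>, Y \<omega>))
      (\<lambda>(x, y). ennreal (normal_density 0 a x) * ennreal (normal_density 0 b y))"
    by (rule distributed_joint_indep[OF _ _ X Y])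
       (use ind in \<open>auto intro: lborel.sigma_finite_measure_axioms
          simp: indep_var_eq cong: measurable_cong_sets\<close>)
  show ?thesis
    unfolding distributed_def
  proof (intro conjI)
    show "?f \<in> borel_measurable (lborel \<Otimes>\<^sub>M lborel)"
      unfolding f_eq by measurable
    show m: "(\<lambda>\<omega>. (X \<omega> + Y \<omega>, X \<omega>)) \<in> measurable M (lborel \<Otimes>\<^sub>M lborel)"
      by measurable
    show "distr M (lborel \<Otimes>\<^sub>M lborel) (\<lambda>\<omega>. (X \<omega> + Y \<omega>, X \<omega>)) =
      density (lborel \<Otimes>\<^sub>M lborel) ?f"
    proof (rule measure_eqI)
      fix A assume "A \<in> sets (distr M (lborel \<Otimes>\<^sub>M lborel) (\<lambda>\<omega>. (X \<omega> + Y \<omega>, X \<omega>)))"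
      then have A[measurable]: "A \<in> sets (lborel \<Otimes>\<^sub>M lborel)" by simp
      have A'[measurable]: "A \<in> sets (borel \<Otimes>\<^sub>M borel)"
        using A by (simp cong: sets_pair_measure_cong)
      have "emeasure (distr M (lborel \<Otimes>\<^sub>M lborel) (\<lambda>\<omega>. (X \<omega> + Y \<omega>, X \<omega>))) A =
          (\<integral>\<^sup>+\<omega>. indicator A (X \<omega> + Y \<omega>, X \<omega>) \<partial>M)"
        using nn_integral_distr[OF m, of "indicator A"] A by simp
      also have "\<dots> = (\<integral>\<^sup>+p. (case p of (x, y) \<Rightarrow> ennreal (normal_density 0 a x) * ennreal (normal_density 0 b y))
            * indicator A (fst p + snd p, fst p) \<partial>(lborel \<Otimes>\<^sub>M lborel))"
        by (subst distributed_nn_integral[OF J]) auto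
      also have "\<dots> = (\<integral>\<^sup>+x. \<integral>\<^sup>+y. ennreal (normal_density 0 a x * normal_density 0 b y)
            * indicator A (x + y, x) \<partial>lborel \<partial>lborel)"
        by (subst lborel.nn_integral_fst[symmetric])
           (auto simp: ennreal_mult normal_density_nonneg)
      also have "\<dots> = (\<integral>\<^sup>+x. \<integral>\<^sup>+z. ennreal (normal_density 0 a x * normal_density 0 b (z - x))
            * indicator A (z, x) \<partial>lborel \<partial>lborel)"
      proof (rule nn_integral_cong)
        fix x :: real
        show "(\<integral>\<^sup>+y. ennreal (normal_density 0 a x * normal_density 0 b y) * indicator A (x + y, x) \<partial>lborel)
          = (\<integral>\<^sup>+z. ennreal (normal_density 0 a x * normal_density 0 b (z - x)) * indicator A (z, x) \<partial>lborel)"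
          by (subst nn_integral_real_affine[where c=1 and t="-x"]) (auto simp: algebra_simps)
      qed
      also have "\<dots> = (\<integral>\<^sup>+p. ?f p * indicator A p \<partial>(lborel \<Otimes>\<^sub>M lborel))"
        unfolding f_eq by (subst lborel_pair.nn_integral_snd[symmetric]) auto
      also have "\<dots> = emeasure (density (lborel \<Otimes>\<^sub>M lborel) ?f) A"
        unfolding f_eq by (subst emeasure_density) auto
      finally show "emeasure (distr M (lborel \<Otimes>\<^sub>M lborel) (\<lambda>\<omega>. (X \<omega> + Y \<omega>, X \<omega>))) A =
        emeasure (density (lborel \<Otimes>\<^sub>M lborel) ?f) A" .
    qed simp
  qed
qed

lemma integrable_normal_zero:
  assumes "distributed M lborel X (normal_density 0 a)" "0 < a"
  shows "integrable M X"
  using distributed_integrable_var[OF assms(1)] integrable_normal_moment_nz_1[OF assms(2)]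
  by (simp add: normal_density_nonneg)

lemma real_cond_exp_normal_sum:
  assumes ind: "indep_var borel X borel Y"
    and a: "0 < a" and b: "0 < b"
    and X: "distributed M lborel X (normal_density 0 a)"
    and Y: "distributed M lborel Y (normal_density 0 b)"
    and S: "S = (\<lambda>\<omega>. X \<omega> + Y \<omega>)"
  shows "AE \<omega> in M. real_cond_exp M (vimage_algebra (space M) S borel) X \<omega> =
    a\<^sup>2 / (a\<^sup>2 + b\<^sup>2) * S \<omega>"
proof -
  have mX[measurable]: "X \<in> borel_measurable M" and mY[measurable]: "Y \<in> borel_measurable M"
    using distributed_measurable[OF X] distributed_measurable[OF Y] by auto
  have mS[measurable]: "S \<in> borel_measurable M" unfolding S by measurable
  have iX: "integrable M X" and iY: "integrable M Y"
    by (fact integrable_normal_zero[OF X a], fact integrable_normal_zero[OF Y b])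
  have iS: "integrable M S" unfolding S using iX iY by simp
  let ?F = "vimage_algebra (space M) S borel"
  interpret sub: finite_measure_subalgebra M ?F
  proof
    show "subalgebra M ?F"
      unfolding subalgebra_def using sets_image_in_sets[OF refl, of S M borel] by simp
  qed
  define s where "s = sqrt (a\<^sup>2 + b\<^sup>2)"
  define c where "c = a\<^sup>2 / (a\<^sup>2 + b\<^sup>2)"
  define v where "v = sqrt (a\<^sup>2 * b\<^sup>2 / (a\<^sup>2 + b\<^sup>2))"
  have v: "0 < v" using a b by (auto simp: v_def intro!: divide_pos_pos add_pos_pos)
  have D: "distributed M (lborel \<Otimes>\<^sub>M lborel) (\<lambda>\<omega>. (S \<omega>, X \<omega>))
      (\<lambda>p. ennreal (normal_density 0 s (fst p) * normal_density (c * fst p) v (snd p)))"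
    using distributed_sum_fst_normal[OF ind a b X Y]
    by (simp add: S s_def c_def v_def case_prod_unfold)
  have DS: "distributed M lborel S (normal_density 0 s)"
    using add_indep_normal[OF ind a b X Y] by (simp add: S s_def)
  show ?thesis
    unfolding c_def[symmetric]
  proof (rule sub.real_cond_exp_charact)
    show "integrable M X" "integrable M (\<lambda>\<omega>. c * S \<omega>)" using iX iS by auto
    show "(\<lambda>\<omega>. c * S \<omega>) \<in> borel_measurable ?F"
      by (intro borel_measurable_times measurable_vimage_algebra1) auto
    fix A assume "A \<in> sets ?F"
    then obtain B where B[measurable]: "B \<in> sets borel" and A: "A = S -` B \<inter> space M"
      by (auto simp: sets_vimage_algebra2)
    let ?g = "\<lambda>p::real \<times> real. indicator B (fst p) * snd p"
    let ?d = "\<lambda>p. normal_density 0 s (fst p) * normal_density (c * fst p) v (snd p)"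
    have iXB: "integrable M (\<lambda>\<omega>. indicator B (S \<omega>) * X \<omega>)"
      by (rule Bochner_Integration.integrable_bound[OF iX]) (auto simp: indicator_def)
    have gm: "?g \<in> borel_measurable (lborel \<Otimes>\<^sub>M lborel)" by measurable
    have d0: "0 \<le> ?d p" for p by (simp add: normal_density_nonneg)
    have int: "integrable (lborel \<Otimes>\<^sub>M lborel) (\<lambda>p. ?d p * ?g p)"
      using distributed_integrable[OF D gm d0] iXB by simp
    have "(LINT \<omega>:A|M. X \<omega>) = (\<integral>\<omega>. indicator B (S \<omega>) * X \<omega> \<partial>M)"
      unfolding set_lebesgue_integral_def
      by (intro Bochner_Integration.integral_cong) (auto simp: A indicator_def)
    also have "\<dots> = (\<integral>p. ?d p * ?g p \<partial>(lborel \<Otimes>\<^sub>M lborel))"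
      using distributed_integral[OF D gm d0] by simp
    also have "\<dots> = (\<integral>z. \<integral>x. ?d (z, x) * ?g (z, x) \<partial>lborel \<partial>lborel)"
      by (rule lborel_pair.integral_fst'[OF int, symmetric])
    also have "\<dots> = (\<integral>z. normal_density 0 s z * (indicator B z * (c * z)) \<partial>lborel)"
    proof (rule Bochner_Integration.integral_cong[OF refl])
      fix z :: real
      have "(\<integral>x. ?d (z, x) * ?g (z, x) \<partial>lborel) =
        (\<integral>x. (normal_density 0 s z * indicator B z) * (normal_density (c * z) v x * x) \<partial>lborel)"
        by (intro Bochner_Integration.integral_cong) auto
      also have "\<dots> = (normal_density 0 s z * indicator B z) * (c * z)"
        by (simp only: integral_mult_right_zero integral_normal_moment_nz_1[OF v])
      finally show "(\<integral>x. ?d (z, x) * ?g (z, x) \<partial>lborel) =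
        normal_density 0 s z * (indicator B z * (c * z))" by (simp add: mult.assoc)
    qed
    also have "\<dots> = (\<integral>\<omega>. indicator B (S \<omega>) * (c * S \<omega>) \<partial>M)"
      by (rule distributed_integral[OF DS]) (auto simp: normal_density_nonneg)
    also have "\<dots> = (LINT \<omega>:A|M. c * S \<omega>)"
      unfolding set_lebesgue_integral_def
      by (intro Bochner_Integration.integral_cong) (auto simp: A indicator_def)
    finally show "(LINT \<omega>:A|M. X \<omega>) = (LINT \<omega>:A|M. c * S \<omega>)" .
  qed
qed

text \<open>Summands with coefficient zero are allowed, which covers the noiseless score.\<close>

lemma real_cond_exp_normal_combination:
  fixes T :: "nat \<Rightarrow> 'a \<Rightarrow> real"
  assumes ind: "indep_vars (\<lambda>_. borel) T I" and fin: "finite I"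
    and T: "\<And>i. i \<in> I \<Longrightarrow> distributed M lborel (T i) std_normal_density"
    and w: "\<And>i. i \<in> I \<Longrightarrow> 0 \<le> w i"
    and jk: "j \<in> I" "0 < w j" "k \<in> I" "0 < w k" "j \<noteq> k"
    and S: "S = (\<lambda>\<omega>. \<Sum>i\<in>I. w i * T i \<omega>)"
  shows "AE \<omega> in M. real_cond_exp M (vimage_algebra (space M) S borel) (\<lambda>\<omega>. w j * T j \<omega>) \<omega> =
    (w j)\<^sup>2 / (\<Sum>i\<in>I. (w i)\<^sup>2) * S \<omega>"
proof -
  define K where "K = {i\<in>I. 0 < w i} - {j}"
  have K: "finite K" "j \<notin> K" "K \<noteq> {}" "insert j K \<subseteq> I" "\<And>i. i \<in> insert j K \<Longrightarrow> 0 < w i"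
    using fin jk by (auto simp: K_def)
  have w0: "w i = 0" if "i \<in> I - insert j K" for i
    using that w[of i] by (auto simp: K_def)
  let ?X = "\<lambda>i \<omega>. w i * T i \<omega>"
  have split: "(\<Sum>i\<in>I. f i) = f j + (\<Sum>i\<in>K. f i)" if "\<And>i. w i = 0 \<Longrightarrow> f i = 0" for f :: "nat \<Rightarrow> real"
  proof -
    have "(\<Sum>i\<in>I. f i) = (\<Sum>i\<in>insert j K. f i)"
      using fin K w0 that by (intro sum.mono_neutral_right) auto
    then show ?thesis using K by simp
  qed
  have ind': "indep_vars (\<lambda>_. borel) ?X (insert j K)"
    by (rule indep_vars_compose2[OF indep_vars_subset[OF ind K(4)]]) auto
  have N: "distributed M lborel (?X i) (normal_density 0 (w i))" if "i \<in> insert j K" for i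
  proof -
    have "0 < w i" "i \<in> I" using K that by auto
    then show ?thesis using normal_density_affine[OF T[of i], of "w i" 0] by simp
  qed
  have NK: "distributed M lborel (\<lambda>\<omega>. \<Sum>i\<in>K. ?X i \<omega>) (normal_density 0 (sqrt (\<Sum>i\<in>K. (w i)\<^sup>2)))"
    using sum_indep_normal[OF K(1,3) indep_vars_subset[OF ind'], of w "\<lambda>_. 0"] K(5) N by auto
  have pos: "0 < (\<Sum>i\<in>K. (w i)\<^sup>2)"
    using K by (intro sum_pos) (auto simp: less_imp_neq[symmetric])
  show ?thesis
    using real_cond_exp_normal_sum[OF indep_vars_sum[OF K(1,2) ind'] _ _ N NK, of S] pos K(5)
    by (simp add: S split real_sqrt_pow2)
qed

end

locale admission_model = prob_space +
  fixes t s Z :: "'a \<Rightarrow> real"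
  assumes indep: "indep_vars (\<lambda>_. borel) (\<lambda>i. [t, s, Z] ! i) {0::nat, 1, 2}"
    and t_normal: "distributed M lborel t std_normal_density"
    and s_normal: "distributed M lborel s std_normal_density"
    and Z_normal: "distributed M lborel Z std_normal_density"
begin

definition score :: "real \<Rightarrow> real \<Rightarrow> 'a \<Rightarrow> real" where
  "score \<alpha> \<sigma>Z \<omega> = \<alpha> * t \<omega> + (1 - \<alpha>) * s \<omega> + \<sigma>Z * Z \<omega>"

definition quality :: "real \<Rightarrow> 'a \<Rightarrow> real" where
  "quality \<beta> \<omega> = \<beta> * t \<omega> + (1 - \<beta>) * s \<omega>"

definition admits :: "real \<Rightarrow> real \<Rightarrow> university \<Rightarrow> 'a \<Rightarrow> bool" where
  "admits \<alpha> \<sigma>Z U \<omega> \<longleftrightarrow>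
     real_cond_exp M (vimage_algebra (space M) (score \<alpha> \<sigma>Z) borel) (quality (fst U)) \<omega> \<ge> snd U"

lemma cond_exp_quality:
  assumes \<alpha>: "0 < \<alpha>" "\<alpha> < 1" and \<sigma>: "0 \<le> \<sigma>Z"
  shows "AE \<omega> in M. real_cond_exp M (vimage_algebra (space M) (score \<alpha> \<sigma>Z) borel) (quality \<beta>) \<omega> =
    (\<alpha> * \<beta> + (1 - \<alpha>) * (1 - \<beta>)) / score_var \<alpha> \<sigma>Z * score \<alpha> \<sigma>Z \<omega>"
proof -
  let ?S = "score \<alpha> \<sigma>Z"
  let ?F = "vimage_algebra (space M) ?S borel"
  let ?w = "\<lambda>i. [\<alpha>, 1 - \<alpha>, \<sigma>Z] ! i"
  have [measurable]: "t \<in> borel_measurable M" "s \<in> borel_measurable M" "Z \<in> borel_measurable M"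
    using distributed_measurable[OF t_normal] distributed_measurable[OF s_normal]
      distributed_measurable[OF Z_normal] by auto
  have it: "integrable M t" and is': "integrable M s"
    by (fact integrable_normal_zero[OF t_normal zero_less_one],
        fact integrable_normal_zero[OF s_normal zero_less_one])
  have [measurable]: "?S \<in> borel_measurable M" unfolding score_def by measurable
  interpret sub: finite_measure_subalgebra M ?F
  proof
    show "subalgebra M ?F"
      unfolding subalgebra_def using sets_image_in_sets[OF refl, of ?S M borel] by simp
  qed
  have S: "?S = (\<lambda>\<omega>. \<Sum>i\<in>{0, 1, 2}. ?w i * ([t, s, Z] ! i) \<omega>)"
    by (simp add: score_def fun_eq_iff)
  have V: "(\<Sum>i\<in>{0, 1, 2::nat}. (?w i)\<^sup>2) = score_var \<alpha> \<sigma>Z"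
    by (simp add: score_var_def)
  have N: "distributed M lborel ([t, s, Z] ! i) std_normal_density" if "i \<in> {0, 1, 2}" for i :: nat
    using that t_normal s_normal Z_normal by auto
  have W: "0 \<le> ?w i" if "i \<in> {0, 1, 2}" for i :: nat
    using that \<alpha> \<sigma> by auto
  have 1: "AE \<omega> in M. real_cond_exp M ?F (\<lambda>\<omega>. \<alpha> * t \<omega>) \<omega> = \<alpha>\<^sup>2 / score_var \<alpha> \<sigma>Z * ?S \<omega>"
    using real_cond_exp_normal_combination[OF indep _ N W _ _ _ _ _ S, of 0 1] \<alpha> V by simp
  have 2: "AE \<omega> in M. real_cond_exp M ?F (\<lambda>\<omega>. (1 - \<alpha>) * s \<omega>) \<omega> = (1 - \<alpha>)\<^sup>2 / score_var \<alpha> \<sigma>Z * ?S \<omega>"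
    using real_cond_exp_normal_combination[OF indep _ N W _ _ _ _ _ S, of 1 0] \<alpha> V by simp
  have 3: "AE \<omega> in M. real_cond_exp M ?F (\<lambda>\<omega>. \<alpha> * t \<omega>) \<omega> = \<alpha> * real_cond_exp M ?F t \<omega>"
    using it by (rule sub.real_cond_exp_cmult)
  have 4: "AE \<omega> in M. real_cond_exp M ?F (\<lambda>\<omega>. (1 - \<alpha>) * s \<omega>) \<omega> = (1 - \<alpha>) * real_cond_exp M ?F s \<omega>"
    using is' by (rule sub.real_cond_exp_cmult)
  have 5: "AE \<omega> in M. real_cond_exp M ?F (\<lambda>\<omega>. \<beta> * t \<omega>) \<omega> = \<beta> * real_cond_exp M ?F t \<omega>"
    using it by (rule sub.real_cond_exp_cmult)
  have 6: "AE \<omega> in M. real_cond_exp M ?F (\<lambda>\<omega>. (1 - \<beta>) * s \<omega>) \<omega> = (1 - \<beta>) * real_cond_exp M ?F s \<omega>"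
    using is' by (rule sub.real_cond_exp_cmult)
  have 7: "AE \<omega> in M. real_cond_exp M ?F (quality \<beta>) \<omega> =
      real_cond_exp M ?F (\<lambda>\<omega>. \<beta> * t \<omega>) \<omega> + real_cond_exp M ?F (\<lambda>\<omega>. (1 - \<beta>) * s \<omega>) \<omega>"
    unfolding quality_def[abs_def] using it is' by (intro sub.real_cond_exp_add) auto
  show ?thesis
    using 1 2 3 4 5 6 7
  proof eventually_elim
    case (elim \<omega>)
    have "real_cond_exp M ?F t \<omega> = \<alpha> / score_var \<alpha> \<sigma>Z * ?S \<omega>"
    proof -
      have "\<alpha> * real_cond_exp M ?F t \<omega> = \<alpha> * (\<alpha> / score_var \<alpha> \<sigma>Z * ?S \<omega>)"
        unfolding elim(3)[symmetric] elim(1) by (simp add: power2_eq_square)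
      then show ?thesis
        using \<alpha> by (subst (asm) mult_cancel_left) simp
    qed
    moreover have "real_cond_exp M ?F s \<omega> = (1 - \<alpha>) / score_var \<alpha> \<sigma>Z * ?S \<omega>"
    proof -
      have "(1 - \<alpha>) * real_cond_exp M ?F s \<omega> = (1 - \<alpha>) * ((1 - \<alpha>) / score_var \<alpha> \<sigma>Z * ?S \<omega>)"
        unfolding elim(4)[symmetric] elim(2) by (simp add: power2_eq_square)
      then show ?thesis
        using \<alpha> by (subst (asm) mult_cancel_left) simp
    qed
    ultimately show ?case
      unfolding elim(7) elim(5) elim(6)
      by (simp only:) (simp only: add_divide_distrib distrib_left distrib_right times_divide_eq_left
          times_divide_eq_right ac_simps)
  qed
qed

theorem admits_iff_score_threshold:
  assumes \<alpha>: "0 < \<alpha>" "\<alpha> < 1" and \<beta>: "0 < \<beta>" "\<beta> < 1" and \<sigma>: "0 \<le> \<sigma>Z"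
  shows "AE \<omega> in M. admits \<alpha> \<sigma>Z (\<beta>, \<tau>Q) \<omega> \<longleftrightarrow> score \<alpha> \<sigma>Z \<omega> \<ge> score_threshold \<alpha> \<sigma>Z \<beta> \<tau>Q"
  using cond_exp_quality[OF \<alpha> \<sigma>, of \<beta>]
proof eventually_elim
  case (elim \<omega>)
  define d where "d = \<alpha> * \<beta> + (1 - \<alpha>) * (1 - \<beta>)"
  have "0 < d" "0 < score_var \<alpha> \<sigma>Z"
    using \<alpha> \<beta> by (auto simp: d_def score_var_def intro!: add_pos_pos add_pos_nonneg)
  then show ?case
    unfolding admits_def score_threshold_def fst_conv snd_conv elim d_def[symmetric]
    by (simp add: pos_le_divide_eq pos_divide_le_eq mult.commute)
qed

end

end

theory Submission
  imports Defs
begin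

text \<open>The score variance is a common positive factor of both score thresholds, so comparing them
  amounts to the sign of \<open>\<alpha> p + (1 - \<alpha>) q\<close>, where \<open>p = \<tau>1 \<beta>2 - \<tau>2 \<beta>1\<close> and
  \<open>q = \<tau>1 (1 - \<beta>2) - \<tau>2 (1 - \<beta>1)\<close>. The three cases are \<open>p > 0\<close>, \<open>q < 0\<close> and \<open>p \<le> 0 \<le> q\<close>; as
  \<open>\<beta>2 < \<beta>1\<close>, the first forces \<open>q > 0\<close>, the second \<open>p < 0\<close>, and in the third \<open>p < q\<close>, so that
  \<open>q / (q - p)\<close> is the unique zero of the affine map.\<close>

text \<open>The numbers \<open>\<alpha>\<close> and \<open>1 - \<alpha>\<close> cannot both vanish,
  so their squares already have a positive sum.\<close>

lemma score_var_pos: "0 < score_var \<alpha> \<sigma>Z"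
proof -
  have "0 < \<alpha>\<^sup>2 + (1 - \<alpha>)\<^sup>2"
    by (cases "\<alpha> = 0") (simp_all add: add_pos_nonneg)
  then show ?thesis
    unfolding score_var_def by (rule add_pos_nonneg) simp
qed

lemma score_weight_pos:
  fixes \<alpha> \<beta> :: real
  assumes "0 < \<alpha>" "\<alpha> < 1" "0 < \<beta>" "\<beta> < 1"
  shows "0 < \<alpha> * \<beta> + (1 - \<alpha>) * (1 - \<beta>)"
  using assms by (intro add_pos_pos mult_pos_pos) auto

text \<open>Both weights \<open>d \<beta>1\<close> and \<open>d \<beta>2\<close> are positive, so
  cross-multiplication preserves the order of the thresholds. After cancelling \<open>v\<close>,
  what remains is affine in \<alpha>.\<close>

lemma more_selective_iff:
  assumes \<alpha>: "0 < \<alpha>" "\<alpha> < 1" and \<beta>: "0 < \<beta>1" "\<beta>1 < 1" "0 < \<beta>2" "\<beta>2 < 1"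
  shows "more_selective \<alpha> \<sigma>Z (\<beta>1, \<tau>1) (\<beta>2, \<tau>2) \<longleftrightarrow>
    0 < \<alpha> * (\<tau>1 * \<beta>2 - \<tau>2 * \<beta>1) + (1 - \<alpha>) * (\<tau>1 * (1 - \<beta>2) - \<tau>2 * (1 - \<beta>1))"
proof -
  define d where "d \<beta> = \<alpha> * \<beta> + (1 - \<alpha>) * (1 - \<beta>)" for \<beta>
  define v where "v = score_var \<alpha> \<sigma>Z"
  have pos: "0 < d \<beta>1" "0 < d \<beta>2" "0 < v"
    using score_weight_pos \<alpha> \<beta> score_var_pos by (simp_all add: d_def v_def)
  have "more_selective \<alpha> \<sigma>Z (\<beta>1, \<tau>1) (\<beta>2, \<tau>2) \<longleftrightarrow> \<tau>2 * v / d \<beta>2 < \<tau>1 * v / d \<beta>1"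
    by (simp add: more_selective_def score_threshold_def d_def v_def)
  also have "\<dots> \<longleftrightarrow> v * (\<tau>2 * d \<beta>1) < v * (\<tau>1 * d \<beta>2)"
    using pos by (simp add: frac_less_eq divide_less_0_iff field_simps)
  also have "\<dots> \<longleftrightarrow> 0 < \<tau>1 * d \<beta>2 - \<tau>2 * d \<beta>1"
    using pos by simp
  also have "\<tau>1 * d \<beta>2 - \<tau>2 * d \<beta>1 =
      \<alpha> * (\<tau>1 * \<beta>2 - \<tau>2 * \<beta>1) + (1 - \<alpha>) * (\<tau>1 * (1 - \<beta>2) - \<tau>2 * (1 - \<beta>1))"
    by (simp add: d_def algebra_simps)
  finally show ?thesis .
qed

text \<open>Trichotomy of the reals: ties then follow from the sign criteria for the two strict
  comparisons.\<close>

lemma equally_selective_iff: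
  "equally_selective \<alpha> \<sigma>Z U V \<longleftrightarrow> \<not> more_selective \<alpha> \<sigma>Z U V \<and> \<not> more_selective \<alpha> \<sigma>Z V U"
  unfolding equally_selective_def more_selective_def by auto

theorem theorem2:
  fixes \<beta>1 \<beta>2 \<tau>1 \<tau>2 \<sigma>Z :: real
  assumes "\<beta>1 \<in> {0<..<1}" and "\<beta>2 \<in> {0<..<1}" and "\<beta>1 > \<beta>2"
    and "\<tau>1 > 0" and "\<tau>2 > 0" and "\<sigma>Z \<ge> 0"
  shows
    "(\<tau>1 / \<tau>2 > \<beta>1 / \<beta>2 \<longrightarrow>
        (\<forall>\<alpha>\<in>{0<..<1}. more_selective \<alpha> \<sigma>Z (\<beta>1, \<tau>1) (\<beta>2, \<tau>2))) \<and>
     (\<tau>1 / \<tau>2 < (1 - \<beta>1) / (1 - \<beta>2) \<longrightarrow>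
        (\<forall>\<alpha>\<in>{0<..<1}. more_selective \<alpha> \<sigma>Z (\<beta>2, \<tau>2) (\<beta>1, \<tau>1))) \<and>
     ((1 - \<beta>1) / (1 - \<beta>2) \<le> \<tau>1 / \<tau>2 \<and> \<tau>1 / \<tau>2 \<le> \<beta>1 / \<beta>2 \<longrightarrow>
        (\<forall>\<alpha>\<in>{0<..<1}.
           (\<alpha> < alpha_th \<beta>1 \<beta>2 \<tau>1 \<tau>2 \<longrightarrow> more_selective \<alpha> \<sigma>Z (\<beta>1, \<tau>1) (\<beta>2, \<tau>2)) \<and>
           (\<alpha> > alpha_th \<beta>1 \<beta>2 \<tau>1 \<tau>2 \<longrightarrow> more_selective \<alpha> \<sigma>Z (\<beta>2, \<tau>2) (\<beta>1, \<tau>1)) \<and>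
           (\<alpha> = alpha_th \<beta>1 \<beta>2 \<tau>1 \<tau>2 \<longrightarrow> equally_selective \<alpha> \<sigma>Z (\<beta>1, \<tau>1) (\<beta>2, \<tau>2))))"
proof -
  define p where "p = \<tau>1 * \<beta>2 - \<tau>2 * \<beta>1"
  define q where "q = \<tau>1 * (1 - \<beta>2) - \<tau>2 * (1 - \<beta>1)"
  have \<beta>: "0 < \<beta>1" "\<beta>1 < 1" "0 < \<beta>2" "\<beta>2 < 1"
    using assms by auto
  have U1: "more_selective \<alpha> \<sigma>Z (\<beta>1, \<tau>1) (\<beta>2, \<tau>2) \<longleftrightarrow> 0 < \<alpha> * p + (1 - \<alpha>) * q"
    if "\<alpha> \<in> {0<..<1}" for \<alpha>
    using more_selective_iff[of \<alpha> \<beta>1 \<beta>2] that \<beta> by (simp add: p_def q_def)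
  \<comment> \<open>Exchanging the universities negates both \<open>p\<close> and
    \<open>q\<close>.\<close>
  have U2: "more_selective \<alpha> \<sigma>Z (\<beta>2, \<tau>2) (\<beta>1, \<tau>1) \<longleftrightarrow> \<alpha> * p + (1 - \<alpha>) * q < 0"
    if "\<alpha> \<in> {0<..<1}" for \<alpha>
    using more_selective_iff[of \<alpha> \<beta>2 \<beta>1] that \<beta> by (simp add: p_def q_def algebra_simps)
  have p_iff: "\<beta>1 / \<beta>2 < \<tau>1 / \<tau>2 \<longleftrightarrow> 0 < p"
    using \<beta> \<open>\<tau>2 > 0\<close> by (simp add: p_def field_simps)
  have q_iff: "\<tau>1 / \<tau>2 < (1 - \<beta>1) / (1 - \<beta>2) \<longleftrightarrow> q < 0"
    using \<beta> \<open>\<tau>2 > 0\<close> by (simp add: q_def field_simps)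
  \<comment> \<open>The number 1 separates the two critical ratios, so
    \<open>\<tau>1 / \<tau>2\<close> cannot lie above the larger and below the smaller at
    once.\<close>
  have "(1 - \<beta>1) / (1 - \<beta>2) < 1" "1 < \<beta>1 / \<beta>2"
    using \<beta> \<open>\<beta>1 > \<beta>2\<close> by simp_all
  then have ratio: "(1 - \<beta>1) / (1 - \<beta>2) < \<beta>1 / \<beta>2"
    by simp
  have i: "0 < \<alpha> * p + (1 - \<alpha>) * q" if "0 < p" "\<alpha> \<in> {0<..<1}" for \<alpha>
  proof -
    have "0 \<le> q"
      using ratio p_iff q_iff that(1) by linarith
    then show ?thesis
      using that by (intro add_pos_nonneg mult_pos_pos mult_nonneg_nonneg) auto
  qed
  have ii: "\<alpha> * p + (1 - \<alpha>) * q < 0" if "q < 0" "\<alpha> \<in> {0<..<1}" for \<alpha>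
  proof -
    have "p \<le> 0"
      using ratio p_iff q_iff that(1) by linarith
    then show ?thesis
      using that by (intro add_nonpos_neg mult_pos_neg mult_nonneg_nonpos) auto
  qed
  have iii: "0 < \<alpha> * p + (1 - \<alpha>) * q \<longleftrightarrow> \<alpha> < alpha_th \<beta>1 \<beta>2 \<tau>1 \<tau>2"
    "\<alpha> * p + (1 - \<alpha>) * q < 0 \<longleftrightarrow> alpha_th \<beta>1 \<beta>2 \<tau>1 \<tau>2 < \<alpha>"
    if "p \<le> 0" "0 \<le> q" for \<alpha>
  proof -
    \<comment> \<open>This keeps the denominator of \<open>alpha_th\<close> nonzero. If both
      \<open>p\<close> and \<open>q\<close> vanish, then \<open>p + q = \<tau>1 - \<tau>2\<close>
      gives equal thresholds, and \<open>p = 0\<close> then gives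
      \<open>\<beta>1 = \<beta>2\<close>.\<close>
    have "p \<noteq> q"
    proof
      assume "p = q"
      then have "p = 0" "q = 0"
        using that by auto
      then have "\<tau>1 * \<beta>2 = \<tau>2 * \<beta>1" "\<tau>1 = \<tau>2"
        by (simp_all add: p_def q_def algebra_simps)
      then show False
        using \<open>\<tau>2 > 0\<close> \<open>\<beta>1 > \<beta>2\<close> by simp
    qed
    then have "p < q"
      using that by simp
    \<comment> \<open>Numerator and denominator match separately; flipping both signs afterwards
      makes the denominator positive.\<close>
    have "alpha_th \<beta>1 \<beta>2 \<tau>1 \<tau>2 = (- q) / (p - q)"
      unfolding alpha_th_def by (rule arg_cong2[of _ _ _ _ "(/)"]) (simp_all add: p_def q_def algebra_simps)
    also have "\<dots> = q / (q - p)"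
      by (metis minus_diff_eq minus_divide_divide minus_minus)
    finally have th: "alpha_th \<beta>1 \<beta>2 \<tau>1 \<tau>2 = q / (q - p)" .
    show "0 < \<alpha> * p + (1 - \<alpha>) * q \<longleftrightarrow> \<alpha> < alpha_th \<beta>1 \<beta>2 \<tau>1 \<tau>2"
      "\<alpha> * p + (1 - \<alpha>) * q < 0 \<longleftrightarrow> alpha_th \<beta>1 \<beta>2 \<tau>1 \<tau>2 < \<alpha>"
      \<comment> \<open>The affine map equals \<open>q - \<alpha> * (q - p)\<close>, so its sign is
        decided by comparing \<alpha> with \<open>q / (q - p)\<close>.\<close>
      using \<open>p < q\<close> by (auto simp: th pos_less_divide_eq pos_divide_less_eq algebra_simps)
  qed
  show ?thesis
  proof (intro conjI impI ballI; (elim conjE)?)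
    fix \<alpha> :: real assume \<alpha>: "\<alpha> \<in> {0<..<1}"
    show "more_selective \<alpha> \<sigma>Z (\<beta>1, \<tau>1) (\<beta>2, \<tau>2)" if "\<tau>1 / \<tau>2 > \<beta>1 / \<beta>2"
      using i U1 \<alpha> that p_iff by blast
    show "more_selective \<alpha> \<sigma>Z (\<beta>2, \<tau>2) (\<beta>1, \<tau>1)" if "\<tau>1 / \<tau>2 < (1 - \<beta>1) / (1 - \<beta>2)"
      using ii U2 \<alpha> that q_iff by blast
    assume "(1 - \<beta>1) / (1 - \<beta>2) \<le> \<tau>1 / \<tau>2" "\<tau>1 / \<tau>2 \<le> \<beta>1 / \<beta>2"
    then have pq: "p \<le> 0" "0 \<le> q"
      using p_iff q_iff by linarith+
    show "more_selective \<alpha> \<sigma>Z (\<beta>1, \<tau>1) (\<beta>2, \<tau>2)" if "\<alpha> < alpha_th \<beta>1 \<beta>2 \<tau>1 \<tau>2"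
      using that iii[OF pq] U1[OF \<alpha>] by simp
    show "more_selective \<alpha> \<sigma>Z (\<beta>2, \<tau>2) (\<beta>1, \<tau>1)" if "\<alpha> > alpha_th \<beta>1 \<beta>2 \<tau>1 \<tau>2"
      using that iii[OF pq] U2[OF \<alpha>] by simp
    show "equally_selective \<alpha> \<sigma>Z (\<beta>1, \<tau>1) (\<beta>2, \<tau>2)" if "\<alpha> = alpha_th \<beta>1 \<beta>2 \<tau>1 \<tau>2"
      \<comment> \<open>At \<open>alpha_th\<close> both strict comparisons become irreflexive
        instances of \<open><\<close>.\<close>
      unfolding equally_selective_iff U1[OF \<alpha>] U2[OF \<alpha>] iii[OF pq] using that by simp
  qed
qed

end
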